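(* Let $d \ge 2$ and let $\mathbf{x} = (x_1, x_2, x_3) \in (\mathbb{R}^d)^3$ be arbitrary. Then the double outer Napoleon transformation $N_-^2(\mathbf{x}) = N_-(N_-(\mathbf{x}))$ is an optimal solution (global minimizer) of the problem $$\text{minimize } \sum_{i=1}^3 \|x_i - y_i\|^2 \quad \text{subject to} \quad \|y_1 - y_2\|^2 = \|y_1 - y_3\|^2 = \|y_2 - y_3\|^2,$$ over $\mathbf{y} = (y_1, y_2, y_3) \in (\mathbb{R}^d)^3$. Further, if $x_1, x_2, x_3$ are non-collinear, then this problem has a unique solution.
   Context: Throughout $d \ge 2$, $\|\cdot\|$ is the Euclidean norm on $\mathbb{R}^d$, and $\mathbf{x} = (x_1,x_2,x_3)$ with $x_i \in \mathbb{R}^d$ is identified with a vector of $\mathbb{R}^{3d}$. The triple is called trivial if $x_1=x_2=x_3$. Rotation matrix $R_{\mathbf{x}}$. For a trivial triple, $R_{\mathbf{x}} = 0$. Otherwise let $n = \frac{x_2-x_1}{\|x_2-x_1\|}$ if $x_1 \ne x_2$ and $n = \frac{x_3-x_2}{\|x_3-x_2\|}$ if $x_1=x_2$. If $\mathbf{x}$ is non-collinear, let $t$ be the unit vector in the direction of $(I_d - n n^{T})(x_3 - x_1)$; if $\mathbf{x}$ is collinear, let $t$ be an arbitrary (chosen and fixed for each $\mathbf{x}$) unit vector orthogonal to $n$. Set $$R_{\mathbf{x}} = [\,n,\ t\,]\begin{bmatrix} 0 & -1 \\ 1 & 0\end{bmatrix}[\,n,\ t\,]^{T},$$ i.e. the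 counter-clockwise rotation by $\pi/2$ in the plane spanned by $(n,t)$, oriented so that $(n,t)$ is a positive basis; in this orientation a non-collinear $\mathbf{x}$ is positively (counter-clockwise) oriented. Torricelli transformations $T_\pm : \mathbb{R}^{3d} \to \mathbb{R}^{3d}$ ($+$ inner, $-$ outer). $T_\pm(\mathbf{x}) = (y_1,y_2,y_3)$, where for each cyclic permutation $(i,j,k)$ of $(1,2,3)$, $y_k$ is the new vertex of the equilateral triangle erected on the side $x_i x_j$ in the plane containing $\mathbf{x}$, inward for $+$ (on the same side of the line $x_ix_j$ as $x_k$) and outward for $-$ (on the opposite side). Precisely, and including the collinear case via the chosen plane and orientation, $y_k$ is the image of $x_j$ under rotation about $x_i$ by $60^\circ$, counter-clockwise for $+$ and clockwise for $-$: $$y_k = \tfrac12 (x_i + x_j) \pm \tfrac{\sqrt3}{2} R_{\mathbf{x}}(x_j - x_i).$$ Napoleon transformations $N_\pm : \mathbb{R}^{3d} \to \mathbb{R}^{3d}$ ($+$ inner, $-$ outer). $N_\pm(\mathbf{x}) = (z_1,z_2,z_3)$, where $z_k = \frac13(x_i + x_j + y_k)$ for $\{i,j,k\}=\{1,2,3\}$ is the centroid of the equilateral triangle erected on the side opposite $x_k$, with $(y_1,y_2,y_3) = T_\pm(\mathbf{x})$. *)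

theory Defs
  imports "HOL-Analysis.Analysis"
begin

text \<open>The space of dimension \<open>d\<close> is \<open>real ^ 'n\<close> with \<open>d = CARD('n)\<close>.\<close>

type_synonym 'n triple = "(real ^ 'n) \<times> (real ^ 'n) \<times> (real ^ 'n)"

fun trivial_triple :: "'n::finite triple \<Rightarrow> bool" where
  "trivial_triple (x1, x2, x3) \<longleftrightarrow> x1 = x2 \<and> x2 = x3"

fun collinear_triple :: "'n::finite triple \<Rightarrow> bool" where
  "collinear_triple (x1, x2, x3) \<longleftrightarrow> collinear {x1, x2, x3}"

fun dir_n :: "'n::finite triple \<Rightarrow> real ^ 'n" where
  "dir_n (x1, x2, x3) =
     (if x1 \<noteq> x2 then (x2 - x1) /\<^sub>R norm (x2 - x1) else (x3 - x2) /\<^sub>R norm (x3 - x2))"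

text \<open>The arbitrary choice of the unit vector \<open>t\<close> for collinear triples is a function \<open>\<tau>\<close>
  that assigns one such vector to every nontrivial collinear triple; its other values are
  never used.\<close>

definition admissible_choice :: "('n::finite triple \<Rightarrow> real ^ 'n) \<Rightarrow> bool" where
  "admissible_choice \<tau> \<longleftrightarrow>
     (\<forall>x. collinear_triple x \<and> \<not> trivial_triple x \<longrightarrow>
        norm (\<tau> x) = 1 \<and> orthogonal (dir_n x) (\<tau> x))"

lemma admissible_choice_exists:
  assumes "CARD('n::finite) \<ge> 2"
  shows "\<exists>\<tau> :: 'n triple \<Rightarrow> real ^ 'n. admissible_choice \<tau>"
proof -
  have "\<exists>t. norm t = 1 \<and> orthogonal (dir_n x) t" for x :: "'n triple"
  proof -
    obtain v :: "real ^ 'n" where "v \<noteq> 0" "orthogonal (dir_n x) v"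
      using orthogonal_to_vector_exists[of "dir_n x"] assms
      by (auto simp: orthogonal_commute)
    then show ?thesis
      by (intro exI[of _ "v /\<^sub>R norm v"]) (auto simp: orthogonal_def)
  qed
  then show ?thesis
    unfolding admissible_choice_def by metis
qed

fun dir_t :: "('n::finite triple \<Rightarrow> real ^ 'n) \<Rightarrow> 'n triple \<Rightarrow> real ^ 'n" where
  "dir_t \<tau> (x1, x2, x3) =
     (if collinear_triple (x1, x2, x3) then \<tau> (x1, x2, x3)
      else let n = dir_n (x1, x2, x3);
               w = (mat 1 - (columnvector n :: real ^ 1 ^ 'n) ** rowvector n) *v (x3 - x1)
           in w /\<^sub>R norm w)"

text \<open>Here \<open>transpose (vector [n, t])\<close> is the matrix with columns \<open>n\<close> and \<open>t\<close>.\<close>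

definition rotation_mat ::
    "('n::finite triple \<Rightarrow> real ^ 'n) \<Rightarrow> 'n triple \<Rightarrow> real ^ 'n ^ 'n" where
  "rotation_mat \<tau> x =
     (if trivial_triple x then 0
      else let P = transpose (vector [dir_n x, dir_t \<tau> x] :: real ^ 'n ^ 2);
               J = vector [vector [0, -1], vector [1, 0]] :: real ^ 2 ^ 2
           in P ** J ** transpose P)"

text \<open>The sign \<open>s\<close> is \<open>1\<close> for the inner and \<open>-1\<close> for the outer transformations.\<close>

fun torricelli ::
    "real \<Rightarrow> ('n::finite triple \<Rightarrow> real ^ 'n) \<Rightarrow> 'n triple \<Rightarrow> 'n triple" where
  "torricelli s \<tau> (x1, x2, x3) =
     (let R = rotation_mat \<tau> (x1, x2, x3);
          apex = (\<lambda>a b. (1 / 2) *\<^sub>R (a + b) + (s * (sqrt 3 / 2)) *\<^sub>R (R *v (b - a)))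
      in (apex x2 x3, apex x3 x1, apex x1 x2))"

fun napoleon ::
    "real \<Rightarrow> ('n::finite triple \<Rightarrow> real ^ 'n) \<Rightarrow> 'n triple \<Rightarrow> 'n triple" where
  "napoleon s \<tau> (x1, x2, x3) =
     (let (y1, y2, y3) = torricelli s \<tau> (x1, x2, x3)
      in ((1 / 3) *\<^sub>R (x2 + x3 + y1), (1 / 3) *\<^sub>R (x3 + x1 + y2), (1 / 3) *\<^sub>R (x1 + x2 + y3)))"

abbreviation inner_napoleon ::
    "('n::finite triple \<Rightarrow> real ^ 'n) \<Rightarrow> 'n triple \<Rightarrow> 'n triple" where
  "inner_napoleon \<equiv> napoleon 1"

abbreviation outer_napoleon ::
    "('n::finite triple \<Rightarrow> real ^ 'n) \<Rightarrow> 'n triple \<Rightarrow> 'n triple" where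
  "outer_napoleon \<equiv> napoleon (- 1)"

fun sq_distance :: "'n::finite triple \<Rightarrow> 'n triple \<Rightarrow> real" where
  "sq_distance (x1, x2, x3) (y1, y2, y3) =
     (norm (x1 - y1))\<^sup>2 + (norm (x2 - y2))\<^sup>2 + (norm (x3 - y3))\<^sup>2"

text \<open>Trivial triples count as equilateral.\<close>

fun equilateral :: "'n::finite triple \<Rightarrow> bool" where
  "equilateral (y1, y2, y3) \<longleftrightarrow>
     (norm (y1 - y2))\<^sup>2 = (norm (y1 - y3))\<^sup>2 \<and> (norm (y1 - y3))\<^sup>2 = (norm (y2 - y3))\<^sup>2"

definition optimal_solution :: "'n::finite triple \<Rightarrow> 'n triple \<Rightarrow> bool" where
  "optimal_solution x y \<longleftrightarrow> is_arg_min (sq_distance x) equilateral y"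

end

theory Submission
  imports Defs
begin

text \<open>Write a triple with centroid \<open>m\<close> in Fourier coordinates \<open>(m, a, b)\<close>. It is equilateral iff
  \<open>a\<close> and \<open>b\<close> are orthogonal and equally long, and the objective is, up to constants, the squared
  Euclidean distance of the coordinates. With \<open>R\<close> the rotation of the triple, \<open>N\<^sub>-\<close> maps
  \<open>(m, a, b)\<close> to \<open>(m, -e, -R e)\<close>, where \<open>e = (a - R b) / 2\<close>. This triple is positively oriented
  with respect to \<open>R\<close>, so it has the same rotation, and therefore \<open>N\<^sub>-\<close> maps it to \<open>(m, e, R e)\<close>,
  the projection of the triple onto the positively oriented equilateral triples in its plane.
  The remainder \<open>(v, - R v)\<close> is negatively oriented with \<open>norm v \<le> norm e\<close>, strictly so for a
  non-collinear triple, and a Cauchy--Schwarz estimate shows that no equilateral triple,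
  in whatever plane, does better.\<close>

section \<open>Oriented planes as skew operators\<close>

text \<open>This is the operator of the wedge product of \<open>u\<close> and \<open>v\<close>. For
  an orthonormal pair it projects onto their plane and makes the quarter turn from \<open>u\<close>
  to \<open>v\<close>, so it encodes the oriented plane and forgets the basis.\<close>

definition bivector :: "'a::real_inner \<Rightarrow> 'a \<Rightarrow> 'a \<Rightarrow> 'a" where
  "bivector u v z = (u \<bullet> z) *\<^sub>R v - (v \<bullet> z) *\<^sub>R u"

definition orthonormal_pair :: "'a::real_inner \<Rightarrow> 'a \<Rightarrow> bool" where
  "orthonormal_pair n t \<longleftrightarrow> n \<bullet> n = 1 \<and> t \<bullet> t = 1 \<and> n \<bullet> t = 0"

lemma orthonormal_pairD:
  assumes "orthonormal_pair n t"
  shows "n \<bullet> n = 1" "t \<bullet> t = 1" "n \<bullet> t = 0" "t \<bullet> n = 0"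
  using assms by (auto simp: orthonormal_pair_def inner_commute)

lemma norm_orthonormal_combination:
  assumes "u \<bullet> u = r\<^sup>2" "v \<bullet> v = r\<^sup>2" "u \<bullet> v = 0"
  shows "(norm (c *\<^sub>R u + s *\<^sub>R v))\<^sup>2 = (c\<^sup>2 + s\<^sup>2) * r\<^sup>2"
proof -
  have "v \<bullet> u = 0"
    using assms(3) by (simp add: inner_commute)
  then show ?thesis
    unfolding power2_norm_eq_inner using assms
    by (simp add: inner_simps power2_eq_square algebra_simps)
qed

lemma bivector_frame:
  assumes "orthonormal_pair n t"
  shows "bivector n t (c *\<^sub>R n + s *\<^sub>R t) = (- s) *\<^sub>R n + c *\<^sub>R t"
  using orthonormal_pairD[OF assms] by (simp add: bivector_def inner_simps)

text \<open>The operator is bilinear and alternating in its two vectors, so a change of basis enters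
  only through its determinant, whose sign compares orientations.\<close>

lemma bivector_combination:
  "bivector (a *\<^sub>R n + b *\<^sub>R t) (c *\<^sub>R n + d *\<^sub>R t) z = (a * d - b * c) *\<^sub>R bivector n t z"
  by (simp add: bivector_def inner_simps algebra_simps)

text \<open>Bessel's inequality: an orthogonal projection onto the plane is followed by an isometry
  of that plane.\<close>

lemma norm_bivector_le:
  assumes "orthonormal_pair n t"
  shows "norm (bivector n t z) \<le> norm z"
proof -
  note f = orthonormal_pairD[OF assms]
  have comm: "z \<bullet> n = n \<bullet> z" "z \<bullet> t = t \<bullet> z"
    by (simp_all add: inner_commute)
  let ?a = "n \<bullet> z" and ?b = "t \<bullet> z"
  have "0 \<le> (norm (z - (?a *\<^sub>R n + ?b *\<^sub>R t)))\<^sup>2"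
    by simp
  also have "\<dots> = (norm z)\<^sup>2 - (?a\<^sup>2 + ?b\<^sup>2)"
    unfolding power2_norm_eq_inner using f
    by (simp add: inner_simps comm power2_eq_square algebra_simps)
  also have "?a\<^sup>2 + ?b\<^sup>2 = (norm (bivector n t z))\<^sup>2"
    unfolding power2_norm_eq_inner bivector_def using f
    by (simp add: inner_simps comm power2_eq_square algebra_simps)
  finally show ?thesis
    by (simp add: power_mono_iff)
qed

text \<open>At \<open>n\<close> the left operator gives the unit vector \<open>t\<close>, while the
  right one cannot lengthen \<open>n\<close>; hence \<open>c \<le> c'\<close>, and by symmetry the
  scalars agree.\<close>

lemma bivector_orthonormal_unique:
  assumes "orthonormal_pair n t" "orthonormal_pair n' t'" "c > 0" "c' > 0"
    and eq: "\<And>z. c *\<^sub>R bivector n t z = c' *\<^sub>R bivector n' t' z"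
  shows "bivector n t z = bivector n' t' z"
proof -
  have *: "p \<le> q"
    if "orthonormal_pair u v" "orthonormal_pair u' v'" "p > 0" "q > 0"
      "p *\<^sub>R bivector u v u = q *\<^sub>R bivector u' v' u"
    for u v u' v' :: 'a and p q :: real
  proof -
    have "bivector u v u = v"
      using orthonormal_pairD[OF that(1)] by (simp add: bivector_def)
    then have "p * norm v = q * norm (bivector u' v' u)"
      using that(3-5) by (metis abs_of_pos norm_scaleR)
    also have "\<dots> \<le> q * norm u"
      using norm_bivector_le[OF that(2)] that(4) by simp
    finally show ?thesis
      using that(1) by (simp add: orthonormal_pair_def norm_eq_sqrt_inner)
  qed
  have "c = c'"
    using *[of n t n' t' c c'] *[of n' t' n t c' c] assms eq by fastforce
  then show ?thesis
    using eq[of z] assms(3) by simp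
qed

section \<open>The rotation matrix in an orthonormal frame\<close>

lemma rotation_mat_mult:
  fixes \<tau> :: "'n::finite triple \<Rightarrow> real ^ 'n"
  assumes "\<not> trivial_triple x"
  shows "rotation_mat \<tau> x *v z = bivector (dir_n x) (dir_t \<tau> x) z"
proof -
  have "(transpose (vector [n, t] :: real ^ 'n ^ 2) **
      (vector [vector [0, -1], vector [1, 0]] :: real ^ 2 ^ 2) **
      transpose (transpose (vector [n, t] :: real ^ 'n ^ 2))) *v z = bivector n t z"
    for n t :: "real ^ 'n"
    unfolding matrix_vector_mul_assoc[symmetric] bivector_def vec_eq_iff
    by (simp add: matrix_vector_mult_def transpose_def sum_2 inner_vec_def algebra_simps)
  then show ?thesis
    using assms by (simp add: rotation_mat_def Let_def)
qed

lemma projection_complement_mult: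
  fixes n z :: "real ^ 'n::finite"
  shows "(mat 1 - (columnvector n :: real ^ 1 ^ 'n) ** rowvector n) *v z = z - (n \<bullet> z) *\<^sub>R n"
proof -
  have "(columnvector n :: real ^ 1 ^ 'n) *v (rowvector n *v z) = (n \<bullet> z) *\<^sub>R n"
    by (simp add: vec_eq_iff matrix_vector_mult_def columnvector_def rowvector_def
        inner_vec_def sum_1)
  then show ?thesis
    by (simp only: matrix_vector_mult_diff_rdistrib matrix_vector_mul_assoc
        matrix_vector_mul_lid)
qed

text \<open>Collects what later steps use of \<open>rotation_mat\<close>. The coefficient
  \<open>\<gamma>\<close> is 0 for collinear triples and \<open>norm w\<close> otherwise, so no
  triple is negatively oriented in its own frame.\<close>

lemma rotation_frame:
  fixes \<tau> :: "'n::finite triple \<Rightarrow> real ^ 'n"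
  assumes "admissible_choice \<tau>" "\<not> trivial_triple (x1, x2, x3)"
  obtains n t \<alpha> \<beta> \<gamma> where
    "orthonormal_pair n t"
    "\<And>z. rotation_mat \<tau> (x1, x2, x3) *v z = bivector n t z"
    "x2 - x1 = \<alpha> *\<^sub>R n" "x3 - x1 = \<beta> *\<^sub>R n + \<gamma> *\<^sub>R t" "\<alpha> * \<gamma> \<ge> 0"
    "\<not> collinear_triple (x1, x2, x3) \<Longrightarrow> \<alpha> * \<gamma> > 0"
proof -
  let ?x = "(x1, x2, x3)"
  define n where "n = dir_n ?x"
  define t where "t = dir_t \<tau> ?x"
  have rot: "rotation_mat \<tau> ?x *v z = bivector n t z" for z
    using rotation_mat_mult[OF assms(2)] by (simp add: n_def t_def)
  have nn: "n \<bullet> n = 1"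
    using assms(2) by (auto simp: n_def dot_square_norm)
  have x2: "x2 - x1 = norm (x2 - x1) *\<^sub>R n"
    by (auto simp: n_def)
  show ?thesis
  proof (cases "collinear_triple ?x")
    case True
    have t: "t = \<tau> ?x"
      using True by (simp add: t_def)
    have "norm t = 1" "orthogonal n t"
      using True assms unfolding admissible_choice_def t n_def by blast+
    then have fr: "orthonormal_pair n t"
      using nn by (simp add: orthonormal_pair_def orthogonal_def dot_square_norm)
    have "\<exists>\<beta>. x3 - x1 = \<beta> *\<^sub>R n"
    \<comment> \<open>For \<open>x1 = x2\<close> the vector \<open>n\<close> comes from
      \<open>x3 - x2\<close>, and \<open>\<alpha>\<close> will be 0.\<close>
    proof (cases "x1 = x2")
      case True
      then have "n = (x3 - x2) /\<^sub>R norm (x3 - x2)" "x3 \<noteq> x2"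
        using assms(2) by (auto simp: n_def)
      then have "x3 - x2 = norm (x3 - x2) *\<^sub>R n"
        by simp
      then have "x3 - x1 = norm (x3 - x2) *\<^sub>R n"
        using True by metis
      then show ?thesis ..
    next
      case False
      have "collinear {0, x2 - x1, x3 - x1}"
        using True collinear_3[of x2 x1 x3] by (simp add: insert_commute)
      then obtain c where "x3 - x1 = c *\<^sub>R (x2 - x1)"
        using False unfolding collinear_lemma by (metis right_minus_eq scaleR_zero_left)
      then show ?thesis
        using x2 by (metis scaleR_scaleR)
    qed
    then obtain \<beta> where "x3 - x1 = \<beta> *\<^sub>R n" ..
    then show ?thesis
      using that[of n t "norm (x2 - x1)" \<beta> 0] fr rot x2 True by simp
  next
    case False
    have ne: "x1 \<noteq> x2"
      using False by auto
    define w where "w = (x3 - x1) - (n \<bullet> (x3 - x1)) *\<^sub>R n"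
    have "(mat 1 - (columnvector n :: real ^ 1 ^ 'n) ** rowvector n) *v (x3 - x1) = w"
      by (simp only: w_def projection_complement_mult)
    then have t: "t = w /\<^sub>R norm w"
      using False unfolding t_def n_def by (simp only: dir_t.simps Let_def if_False)
    have "w \<noteq> 0"
    proof
      assume "w = 0"
      then have "x3 - x1 = (n \<bullet> (x3 - x1)) *\<^sub>R n"
        by (simp add: w_def)
      also have "n = (1 / norm (x2 - x1)) *\<^sub>R (x2 - x1)"
        using ne by (simp add: n_def divide_inverse)
      finally obtain c where c: "x3 - x1 = c *\<^sub>R (x2 - x1)"
        by (metis scaleR_scaleR)
      then have "collinear {0, x2 - x1, x3 - x1}"
        unfolding collinear_lemma by blast
      then show False
        using False collinear_3[of x2 x1 x3] by (simp add: insert_commute)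
    qed
    have fr: "orthonormal_pair n t"
      using nn \<open>w \<noteq> 0\<close> unfolding orthonormal_pair_def t
      by (simp add: w_def inner_simps dot_square_norm power2_eq_square)
    have "x3 - x1 = (n \<bullet> (x3 - x1)) *\<^sub>R n + norm w *\<^sub>R t"
      using \<open>w \<noteq> 0\<close> by (simp add: t) (simp add: w_def)
    then show ?thesis
      using that[of n t "norm (x2 - x1)" "n \<bullet> (x3 - x1)" "norm w"] fr rot x2 \<open>w \<noteq> 0\<close> ne
      by simp
  qed
qed

text \<open>The edges give a positive multiple both of the triple's own rotation and of
  \<open>bivector n t\<close>, so uniqueness identifies the two. The rotation of a new triple is
  thus found without computing its \<open>dir_n\<close> and \<open>dir_t\<close>.\<close>

lemma rotation_mat_eq_bivector:
  fixes \<tau> :: "'n::finite triple \<Rightarrow> real ^ 'n"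
  assumes "admissible_choice \<tau>" "orthonormal_pair n t" "c > 0"
    and biv: "\<And>z. bivector (x2 - x1) (x3 - x1) z = c *\<^sub>R bivector n t z"
  shows "rotation_mat \<tau> (x1, x2, x3) *v z = bivector n t z"
proof -
  \<comment> \<open>Since \<open>n\<close> is sent to \<open>t\<close>, the edge bivector does not
    vanish; this excludes trivial triples and later gives
    \<open>\<alpha> * \<gamma> \<noteq> 0\<close>.\<close>
  have ne: "bivector n t n \<noteq> 0"
    using orthonormal_pairD[OF assms(2)] by (auto simp: bivector_def)
  then have "bivector (x2 - x1) (x3 - x1) n \<noteq> 0"
    using biv assms(3) by simp
  then have "\<not> trivial_triple (x1, x2, x3)"
    by (auto simp: bivector_def)
  then obtain n' t' \<alpha> \<beta> \<gamma> where *: "orthonormal_pair n' t'"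
    "\<And>z. rotation_mat \<tau> (x1, x2, x3) *v z = bivector n' t' z"
    "x2 - x1 = \<alpha> *\<^sub>R n'" "x3 - x1 = \<beta> *\<^sub>R n' + \<gamma> *\<^sub>R t'" "\<alpha> * \<gamma> \<ge> 0"
    using rotation_frame[OF assms(1)] by metis
  have eq: "c *\<^sub>R bivector n t z = (\<alpha> * \<gamma>) *\<^sub>R bivector n' t' z" for z
    using bivector_combination[of \<alpha> n' 0 t' \<beta> \<gamma> z] *(3,4) biv[of z] by simp
  have "\<alpha> * \<gamma> \<noteq> 0"
    using eq[of n] ne assms(3) by auto
  then have "\<alpha> * \<gamma> > 0"
    using *(5) by (metis order_le_less)
  then show ?thesis
    using bivector_orthonormal_unique[OF assms(2) *(1) assms(3) _ eq] *(2) by simp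
qed

section \<open>Fourier coordinates of a triple\<close>

text \<open>Discrete Fourier coordinates: the vertices are
  \<open>m + cos \<theta> a + sin \<theta> b\<close> for \<open>\<theta> = 0, 2\<pi>/3, 4\<pi>/3\<close>.\<close>

definition fourier_triple :: "real ^ 'n \<Rightarrow> real ^ 'n \<Rightarrow> real ^ 'n \<Rightarrow> 'n::finite triple" where
  "fourier_triple m a b =
     (m + a, m - (1/2) *\<^sub>R a + (sqrt 3 / 2) *\<^sub>R b, m - (1/2) *\<^sub>R a - (sqrt 3 / 2) *\<^sub>R b)"

lemma triple_eq_fourier:
  fixes x1 x2 x3 :: "real ^ 'n::finite"
  shows "(x1, x2, x3) = fourier_triple ((1/3) *\<^sub>R (x1 + x2 + x3))
    ((1/3) *\<^sub>R (2 *\<^sub>R x1 - x2 - x3)) ((1 / sqrt 3) *\<^sub>R (x2 - x3))"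
proof -
  have "(sqrt 3 / 2) *\<^sub>R ((1 / sqrt 3) *\<^sub>R v) = (1/2) *\<^sub>R v" for v :: "real ^ 'n"
    by simp
  then show ?thesis
    unfolding fourier_triple_def by (simp only:) (simp add: vec_eq_iff field_simps)
qed

text \<open>Parseval's identity: all mixed terms between the three coordinate differences cancel in
  the sum.\<close>

lemma sq_distance_fourier:
  "sq_distance (fourier_triple m a b) (fourier_triple m' p q) =
     3 * (norm (m - m'))\<^sup>2 + 3/2 * ((norm (a - p))\<^sup>2 + (norm (b - q))\<^sup>2)"
proof -
  define u v w where "u = m - m'" and "v = a - p" and "w = b - q"
  have "m + a - (m' + p) = u + v"
    "m - (1/2) *\<^sub>R a + (sqrt 3 / 2) *\<^sub>R b - (m' - (1/2) *\<^sub>R p + (sqrt 3 / 2) *\<^sub>R q)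
      = u - (1/2) *\<^sub>R v + (sqrt 3 / 2) *\<^sub>R w"
    "m - (1/2) *\<^sub>R a - (sqrt 3 / 2) *\<^sub>R b - (m' - (1/2) *\<^sub>R p - (sqrt 3 / 2) *\<^sub>R q)
      = u - (1/2) *\<^sub>R v - (sqrt 3 / 2) *\<^sub>R w"
    by (simp_all add: u_def v_def w_def algebra_simps)
  then have "sq_distance (fourier_triple m a b) (fourier_triple m' p q) =
     (norm (u + v))\<^sup>2 + (norm (u - (1/2) *\<^sub>R v + (sqrt 3 / 2) *\<^sub>R w))\<^sup>2
      + (norm (u - (1/2) *\<^sub>R v - (sqrt 3 / 2) *\<^sub>R w))\<^sup>2"
    by (simp add: fourier_triple_def)
  also have "\<dots> = 3 * (norm u)\<^sup>2 + 3/2 * ((norm v)\<^sup>2 + (norm w)\<^sup>2)"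
    unfolding power2_norm_eq_inner by (simp add: inner_simps inner_commute field_simps)
  finally show ?thesis
    by (simp add: u_def v_def w_def)
qed

text \<open>The first equality of sides isolates \<open>p \<bullet> q\<close>; once that vanishes,
  the second compares only the two lengths.\<close>

lemma equilateral_fourier:
  "equilateral (fourier_triple m p q) \<longleftrightarrow> p \<bullet> p = q \<bullet> q \<and> p \<bullet> q = 0"
proof -
  have sides: "m + p - (m - (1/2) *\<^sub>R p + (sqrt 3 / 2) *\<^sub>R q) = (3/2) *\<^sub>R p - (sqrt 3 / 2) *\<^sub>R q"
    "m + p - (m - (1/2) *\<^sub>R p - (sqrt 3 / 2) *\<^sub>R q) = (3/2) *\<^sub>R p + (sqrt 3 / 2) *\<^sub>R q"
    "m - (1/2) *\<^sub>R p + (sqrt 3 / 2) *\<^sub>R q - (m - (1/2) *\<^sub>R p - (sqrt 3 / 2) *\<^sub>R q)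
      = sqrt 3 *\<^sub>R q"
    by (simp_all add: vec_eq_iff field_simps)
  have norms: "(norm ((3/2) *\<^sub>R p - (sqrt 3 / 2) *\<^sub>R q))\<^sup>2
      = 9/4 * (p \<bullet> p) + 3/4 * (q \<bullet> q) - 3 * sqrt 3 / 2 * (p \<bullet> q)"
    "(norm ((3/2) *\<^sub>R p + (sqrt 3 / 2) *\<^sub>R q))\<^sup>2
      = 9/4 * (p \<bullet> p) + 3/4 * (q \<bullet> q) + 3 * sqrt 3 / 2 * (p \<bullet> q)"
    "(norm (sqrt 3 *\<^sub>R q))\<^sup>2 = 3 * (q \<bullet> q)"
    unfolding power2_norm_eq_inner by (simp_all add: inner_simps inner_commute field_simps)
  have "equilateral (fourier_triple m p q) \<longleftrightarrow>
      - 3 * sqrt 3 * (p \<bullet> q) = 0 \<and>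
      9/4 * (p \<bullet> p - q \<bullet> q) + 3 * sqrt 3 / 2 * (p \<bullet> q) = 0"
    unfolding fourier_triple_def equilateral.simps sides norms by (auto simp: field_simps)
  then show ?thesis
    by auto
qed

text \<open>The determinant from \<open>(a, b)\<close> to the edges is positive, so
  \<open>(a, b)\<close> carries the orientation of the triple.\<close>

lemma bivector_fourier:
  assumes "fourier_triple m a b = (x1, x2, x3)"
  shows "bivector (x2 - x1) (x3 - x1) z = (3 * sqrt 3 / 2) *\<^sub>R bivector a b z"
proof -
  have x: "x1 = m + a" "x2 = m - (1/2) *\<^sub>R a + (sqrt 3 / 2) *\<^sub>R b"
    "x3 = m - (1/2) *\<^sub>R a - (sqrt 3 / 2) *\<^sub>R b"
    using assms by (auto simp: fourier_triple_def)
  have d: "x2 - x1 = (- 3/2) *\<^sub>R a + (sqrt 3 / 2) *\<^sub>R b"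
    "x3 - x1 = (- 3/2) *\<^sub>R a + (- sqrt 3 / 2) *\<^sub>R b"
    unfolding x by (simp_all add: vec_eq_iff algebra_simps)
  show ?thesis
    unfolding d bivector_combination by simp
qed

text \<open>The rotation acts on edges only, so the centroid is kept; the rest is a linear identity
  in which the \<open>sqrt 3\<close> of an apex meets the \<open>sqrt 3\<close> of an edge.\<close>

lemma outer_napoleon_fourier:
  fixes \<tau> :: "'n::finite triple \<Rightarrow> real ^ 'n"
  defines "R \<equiv> \<lambda>a b m. (*v) (rotation_mat \<tau> (fourier_triple m a b))"
  shows "outer_napoleon \<tau> (fourier_triple m a b) =
    fourier_triple m (- (1/2) *\<^sub>R (a - R a b m b)) (- (1/2) *\<^sub>R (b + R a b m a))"
proof -
  have s: "sqrt 3 * (sqrt 3 * r) = 3 * r" for r :: real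
    by (simp add: mult.assoc[symmetric])
  show ?thesis
    unfolding R_def
    by (simp add: fourier_triple_def Let_def matrix_vector_mult_diff_distrib
        matrix_vector_right_distrib matrix_vector_mult_scaleR)
      (simp add: vec_eq_iff field_simps s)
qed

section \<open>Approximation by conformal pairs\<close>

text \<open>Here \<open>(e, f)\<close> is the positively and \<open>(v, - v')\<close> the negatively oriented part of the
  data. The left-hand side minus the right-hand side is
  \<open>2 l (k\<^sup>2 + r\<^sup>2 - 2 k (g \<bullet> h))\<close> with \<open>norm g = 1\<close> and \<open>norm h = r\<close>; the half
  angles \<open>\<mu>\<close>, \<open>\<nu>\<close> produce \<open>g\<close> and \<open>h\<close>.\<close>

lemma conformal_approximation_polar:
  fixes n t p q :: "'a::real_inner" and k l \<mu> \<nu> :: real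
  defines "e \<equiv> k *\<^sub>R (cos (\<mu> + \<nu>) *\<^sub>R n + sin (\<mu> + \<nu>) *\<^sub>R t)"
    and "f \<equiv> k *\<^sub>R ((- sin (\<mu> + \<nu>)) *\<^sub>R n + cos (\<mu> + \<nu>) *\<^sub>R t)"
    and "v \<equiv> l *\<^sub>R (cos (\<mu> - \<nu>) *\<^sub>R n + sin (\<mu> - \<nu>) *\<^sub>R t)"
    and "v' \<equiv> l *\<^sub>R ((- sin (\<mu> - \<nu>)) *\<^sub>R n + cos (\<mu> - \<nu>) *\<^sub>R t)"
  assumes fr: "orthonormal_pair n t" and pq: "p \<bullet> p = q \<bullet> q" "p \<bullet> q = 0"
    and "0 \<le> k" "0 \<le> l"
  shows "k * ((norm (e + v - p))\<^sup>2 + (norm (f - v' - q))\<^sup>2) \<ge>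
    2 * k * l\<^sup>2 + (k - l) * ((norm (e - p))\<^sup>2 + (norm (f - q))\<^sup>2)"
proof -
  note o = orthonormal_pairD[OF fr]
  have comm: "p \<bullet> e = e \<bullet> p" "q \<bullet> f = f \<bullet> q" "p \<bullet> v = v \<bullet> p" "q \<bullet> v' = v' \<bullet> q"
    "v \<bullet> e = e \<bullet> v" "v' \<bullet> f = f \<bullet> v'"
    by (simp_all add: inner_commute)
  define r where "r = norm p"
  have r: "p \<bullet> p = r\<^sup>2" "q \<bullet> q = r\<^sup>2" "r \<ge> 0"
    using pq by (auto simp: r_def dot_square_norm)
  define g where "g = cos \<mu> *\<^sub>R n + sin \<mu> *\<^sub>R t"
  define h where "h = cos \<nu> *\<^sub>R p + (- sin \<nu>) *\<^sub>R q"
  have "(norm g)\<^sup>2 = 1\<^sup>2"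
    unfolding g_def by (subst norm_orthonormal_combination[where r = 1]) (auto simp: o)
  then have ng: "norm g = 1"
    by (rule power2_eq_imp_eq) auto
  have "(norm h)\<^sup>2 = r\<^sup>2"
    unfolding h_def by (subst norm_orthonormal_combination[where r = r]) (auto simp: r pq)
  then have nh: "norm h = r"
    by (rule power2_eq_imp_eq) (use r in auto)
  have gh: "g \<bullet> h \<le> r"
    using norm_cauchy_schwarz[of g h] ng nh by simp
  define E where "E = cos (\<mu> + \<nu>) * (n \<bullet> p) + sin (\<mu> + \<nu>) * (t \<bullet> p)
    - sin (\<mu> + \<nu>) * (n \<bullet> q) + cos (\<mu> + \<nu>) * (t \<bullet> q)"
  define V where "V = cos (\<mu> - \<nu>) * (n \<bullet> p) + sin (\<mu> - \<nu>) * (t \<bullet> p)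
    + sin (\<mu> - \<nu>) * (n \<bullet> q) - cos (\<mu> - \<nu>) * (t \<bullet> q)"
  \<comment> \<open>Sum-to-product formulas move \<open>\<mu>\<close> onto the frame and
    \<open>\<nu>\<close> onto \<open>(p, q)\<close>, leaving a single inner product.\<close>
  have EV: "E + V = 2 * (g \<bullet> h)"
    by (simp add: E_def V_def g_def h_def inner_simps cos_add cos_diff sin_add sin_diff
        algebra_simps)
  have ee: "e \<bullet> e = k\<^sup>2" "f \<bullet> f = k\<^sup>2" "v \<bullet> v = l\<^sup>2" "v' \<bullet> v' = l\<^sup>2"
    unfolding e_def f_def v_def v'_def power2_norm_eq_inner[symmetric] norm_scaleR
      power_mult_distrib
    by (subst norm_orthonormal_combination[where r = 1]; simp add: o)+
  \<comment> \<open>The same quarter turn relates \<open>e\<close> to \<open>f\<close> and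
    \<open>v\<close> to \<open>v'\<close>; hence \<open>(e, f)\<close> and \<open>(v, - v')\<close>
    are orthogonal as pairs.\<close>
  have ev: "e \<bullet> v = f \<bullet> v'"
    unfolding e_def f_def v_def v'_def by (simp add: inner_simps o algebra_simps)
  have kE: "e \<bullet> p + f \<bullet> q = k * E" and lV: "v \<bullet> p - v' \<bullet> q = l * V"
    unfolding e_def f_def v_def v'_def E_def V_def by (simp_all add: inner_simps algebra_simps)
  have 1: "(norm (e - p))\<^sup>2 + (norm (f - q))\<^sup>2 = 2 * k\<^sup>2 + 2 * r\<^sup>2 - 2 * (k * E)"
    unfolding power2_norm_eq_inner kE[symmetric]
    by (simp add: inner_simps comm ee r)
  have 2: "(norm (e + v - p))\<^sup>2 + (norm (f - v' - q))\<^sup>2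
      = 2 * k\<^sup>2 + 2 * l\<^sup>2 + 2 * r\<^sup>2 - 2 * (k * E + l * V)"
    unfolding power2_norm_eq_inner kE[symmetric] lV[symmetric]
    by (simp add: inner_simps comm ee r ev)
  \<comment> \<open>The difference of the two sides as a square plus a Cauchy--Schwarz
    defect.\<close>
  have "0 \<le> 2 * l * ((k - r)\<^sup>2 + 2 * k * (r - g \<bullet> h))"
    using assms(8,9) gh by simp
  also have "\<dots> = 2 * l * (k\<^sup>2 + r\<^sup>2 - k * (E + V))"
    unfolding EV by (simp add: power2_eq_square algebra_simps)
  also have "\<dots> = k * (2 * k\<^sup>2 + 2 * l\<^sup>2 + 2 * r\<^sup>2 - 2 * (k * E + l * V))
     - (2 * k * l\<^sup>2 + (k - l) * (2 * k\<^sup>2 + 2 * r\<^sup>2 - 2 * (k * E)))"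
    by (simp add: power2_eq_square algebra_simps)
  finally show ?thesis
    unfolding 1 2 by simp
qed

lemma polar_nonneg:
  fixes x y :: real
  obtains k \<theta> where "k \<ge> 0" "x = k * cos \<theta>" "y = k * sin \<theta>"
proof
  show "norm (Complex x y) \<ge> 0" by simp
  show "x = norm (Complex x y) * cos (Arg (Complex x y))"
    "y = norm (Complex x y) * sin (Arg (Complex x y))"
    using Arg_eq[of "Complex x y"] rcis_cmod_Arg[of "Complex x y"]
    by (metis Re_rcis complex.sel(1), metis Im_rcis complex.sel(2) rcis_cmod_Arg)
qed

text \<open>The data split into a conformal part of radius \<open>k\<close> and an anticonformal
  part of radius \<open>l\<close>, with determinant \<open>k\<^sup>2 - l\<^sup>2\<close>; so
  \<open>area\<close> gives \<open>l \<le> k\<close>. Dividing the polar estimate by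
  \<open>k\<close> yields \<open>\<kappa> = 1 - l / k\<close>.\<close>

lemma conformal_approximation:
  fixes n t p q :: "'a::real_inner" and a1 a2 b1 b2 :: real
  defines "a \<equiv> a1 *\<^sub>R n + a2 *\<^sub>R t" and "b \<equiv> b1 *\<^sub>R n + b2 *\<^sub>R t"
    and "e \<equiv> ((a1 + b2) / 2) *\<^sub>R n + ((a2 - b1) / 2) *\<^sub>R t"
    and "f \<equiv> (- ((a2 - b1) / 2)) *\<^sub>R n + ((a1 + b2) / 2) *\<^sub>R t"
  assumes fr: "orthonormal_pair n t" and pq: "p \<bullet> p = q \<bullet> q" "p \<bullet> q = 0"
    and area: "a1 * b2 - a2 * b1 \<ge> 0" and ne: "a \<noteq> 0 \<or> b \<noteq> 0"
  obtains \<kappa> where "\<kappa> \<ge> 0" "a1 * b2 - a2 * b1 > 0 \<Longrightarrow> \<kappa> > 0"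
    "(norm (a - p))\<^sup>2 + (norm (b - q))\<^sup>2 \<ge> (norm (a - e))\<^sup>2 + (norm (b - f))\<^sup>2
      + \<kappa> * ((norm (e - p))\<^sup>2 + (norm (f - q))\<^sup>2)"
proof -
  note o = orthonormal_pairD[OF fr]
  \<comment> \<open>With \<open>R = bivector n t\<close>, these are polar coordinates of
    \<open>(a - R b) / 2\<close>, and those with \<open>l\<close> and \<open>\<beta>\<close> are of
    \<open>(a + R b) / 2\<close>.\<close>
  obtain k \<alpha> where k: "k \<ge> 0" "(a1 + b2) / 2 = k * cos \<alpha>" "(a2 - b1) / 2 = k * sin \<alpha>"
    using polar_nonneg by metis
  obtain l \<beta> where l: "l \<ge> 0" "(a1 - b2) / 2 = l * cos \<beta>" "(a2 + b1) / 2 = l * sin \<beta>"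
    using polar_nonneg by metis
  have coord: "a1 = k * cos \<alpha> + l * cos \<beta>" "b2 = k * cos \<alpha> - l * cos \<beta>"
    "a2 = k * sin \<alpha> + l * sin \<beta>" "b1 = l * sin \<beta> - k * sin \<alpha>"
    using k l by (simp_all add: field_simps)
  have "a1 * b2 - a2 * b1 = k\<^sup>2 * ((cos \<alpha>)\<^sup>2 + (sin \<alpha>)\<^sup>2) - l\<^sup>2 * ((cos \<beta>)\<^sup>2 + (sin \<beta>)\<^sup>2)"
    unfolding coord by algebra
  then have ar: "a1 * b2 - a2 * b1 = k\<^sup>2 - l\<^sup>2"
    by simp
  have lk: "l \<le> k"
    using ar area k(1) l(1) by (simp add: power_mono_iff)
  \<comment> \<open>With \<open>k = 0\<close> also \<open>l = 0\<close>, hence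
    \<open>a = b = 0\<close>; positivity permits the final division.\<close>
  have "k > 0"
  proof (rule ccontr)
    assume "\<not> k > 0"
    then have "k = 0" "l = 0" using k(1) l(1) lk by auto
    then show False using ne coord by (simp add: a_def b_def)
  qed
  define \<mu> \<nu> where "\<mu> = (\<alpha> + \<beta>) / 2" and "\<nu> = (\<alpha> - \<beta>) / 2"
  have ang: "\<mu> + \<nu> = \<alpha>" "\<mu> - \<nu> = \<beta>"
    by (simp_all add: \<mu>_def \<nu>_def field_simps)
  define v v' where "v = l *\<^sub>R (cos \<beta> *\<^sub>R n + sin \<beta> *\<^sub>R t)"
    and "v' = l *\<^sub>R ((- sin \<beta>) *\<^sub>R n + cos \<beta> *\<^sub>R t)"
  have e: "e = k *\<^sub>R (cos \<alpha> *\<^sub>R n + sin \<alpha> *\<^sub>R t)"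
    unfolding e_def k by (simp add: algebra_simps)
  have f: "f = k *\<^sub>R ((- sin \<alpha>) *\<^sub>R n + cos \<alpha> *\<^sub>R t)"
    unfolding f_def k by (simp add: algebra_simps)
  have a: "a = e + v" and b: "b = f - v'"
    by (simp_all add: a_def b_def e f v_def v'_def coord algebra_simps)
  have vv: "(norm v)\<^sup>2 = l\<^sup>2" "(norm v')\<^sup>2 = l\<^sup>2"
    unfolding v_def v'_def norm_scaleR power_mult_distrib
    by (subst norm_orthonormal_combination[where r = 1]; simp add: o)+
  have ab: "(norm (a - e))\<^sup>2 + (norm (b - f))\<^sup>2 = 2 * l\<^sup>2"
    using vv by (simp add: a b)
  have main: "k * ((norm (a - p))\<^sup>2 + (norm (b - q))\<^sup>2) \<ge>
      2 * k * l\<^sup>2 + (k - l) * ((norm (e - p))\<^sup>2 + (norm (f - q))\<^sup>2)"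
    using conformal_approximation_polar[OF fr pq k(1) l(1), of \<mu> \<nu>]
    unfolding ang a b e f v_def v'_def .
  show ?thesis
  proof (rule that[of "(k - l) / k"])
    show "(k - l) / k \<ge> 0" using lk k(1) by simp
    show "(k - l) / k > 0" if "a1 * b2 - a2 * b1 > 0"
      using that ar \<open>k > 0\<close> l(1) lk by (cases "l = k") auto
    show "(norm (a - p))\<^sup>2 + (norm (b - q))\<^sup>2 \<ge> (norm (a - e))\<^sup>2 + (norm (b - f))\<^sup>2
      + (k - l) / k * ((norm (e - p))\<^sup>2 + (norm (f - q))\<^sup>2)"
      using main \<open>k > 0\<close> unfolding ab by (simp add: field_simps)
  qed
qed

section \<open>The double outer Napoleon transformation\<close>

lemma double_outer_napoleon_trivial:
  "outer_napoleon \<tau> (outer_napoleon \<tau> (x, x, x)) = (x, x, x)"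
proof -
  have "outer_napoleon \<tau> (x, x, x) = (x, x, x)"
    by (simp add: Let_def vec_eq_iff)
  then show ?thesis by metis
qed

text \<open>The first image has coordinates \<open>(- e, - f)\<close> with determinant
  \<open>c\<^sup>2 + s\<^sup>2 > 0\<close>, so it is non-collinear and inherits the rotation, even
  one chosen arbitrarily for a collinear triple. The second application then only flips
  signs.\<close>

lemma double_outer_napoleon_fourier:
  fixes \<tau> :: "'n::finite triple \<Rightarrow> real ^ 'n"
  assumes "admissible_choice \<tau>" and fr: "orthonormal_pair n t"
    and rot: "\<And>z. rotation_mat \<tau> (fourier_triple m a b) *v z = bivector n t z"
    and a: "a = a1 *\<^sub>R n + a2 *\<^sub>R t" and b: "b = b1 *\<^sub>R n + b2 *\<^sub>R t"
    and area: "a1 * b2 - a2 * b1 \<ge> 0" and ne: "a \<noteq> 0 \<or> b \<noteq> 0"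
  shows "outer_napoleon \<tau> (outer_napoleon \<tau> (fourier_triple m a b)) =
    fourier_triple m (((a1 + b2) / 2) *\<^sub>R n + ((a2 - b1) / 2) *\<^sub>R t)
      ((- ((a2 - b1) / 2)) *\<^sub>R n + ((a1 + b2) / 2) *\<^sub>R t)"
proof -
  define c s where "c = (a1 + b2) / 2" and "s = (a2 - b1) / 2"
  define e f where "e = c *\<^sub>R n + s *\<^sub>R t" and "f = (- s) *\<^sub>R n + c *\<^sub>R t"
  have "a - bivector n t b = 2 *\<^sub>R e" "b + bivector n t a = 2 *\<^sub>R f"
    unfolding a b bivector_frame[OF fr] e_def f_def
    by (simp_all add: c_def s_def vec_eq_iff field_simps)
  then have N: "outer_napoleon \<tau> (fourier_triple m a b) = fourier_triple m (- e) (- f)"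
    by (simp only: outer_napoleon_fourier rot) simp
  \<comment> \<open>If \<open>c = s = 0\<close>, the determinant in \<open>area\<close> equals
    \<open>- (a1\<^sup>2 + a2\<^sup>2)\<close>, which forces \<open>a = b = 0\<close>.\<close>
  have pos: "c\<^sup>2 + s\<^sup>2 > 0"
  proof (rule ccontr)
    assume "\<not> c\<^sup>2 + s\<^sup>2 > 0"
    then have cs: "b2 = - a1" "b1 = a2"
      by (auto simp: sum_power2_gt_zero_iff c_def s_def)
    have "a1\<^sup>2 + a2\<^sup>2 \<le> 0"
      using area by (simp add: cs power2_eq_square)
    then have "a1 = 0 \<and> a2 = 0"
      by (simp add: sum_power2_le_zero_iff)
    then show False
      using ne cs by (simp add: a b)
  qed
  obtain z1 z2 z3 where z: "fourier_triple m (- e) (- f) = (z1, z2, z3)"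
    by (cases "fourier_triple m (- e) (- f)")
  have "bivector (- e) (- f) w = (c\<^sup>2 + s\<^sup>2) *\<^sub>R bivector n t w" for w
    using bivector_combination[of "- c" n "- s" t s "- c" w]
    by (simp add: e_def f_def power2_eq_square algebra_simps)
  then have "bivector (z2 - z1) (z3 - z1) w = (3 * sqrt 3 / 2 * (c\<^sup>2 + s\<^sup>2)) *\<^sub>R bivector n t w"
    for w
    by (simp add: bivector_fourier[OF z])
  then have rot': "rotation_mat \<tau> (fourier_triple m (- e) (- f)) *v w = bivector n t w" for w
    unfolding z using pos
    by (intro rotation_mat_eq_bivector[OF assms(1) fr, of "3 * sqrt 3 / 2 * (c\<^sup>2 + s\<^sup>2)"]) auto
  have "bivector n t (- f) = e" "bivector n t (- e) = - f"
    using bivector_frame[OF fr, of s "- c"] bivector_frame[OF fr, of "- c" "- s"]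
    by (simp_all add: e_def f_def)
  then have "outer_napoleon \<tau> (fourier_triple m (- e) (- f)) = fourier_triple m e f"
    by (simp only: outer_napoleon_fourier rot') (simp add: vec_eq_iff fourier_triple_def)
  then show ?thesis
    unfolding N by (simp add: e_def f_def c_def s_def)
qed

section \<open>Optimality and uniqueness\<close>

theorem theorem1:
  fixes \<tau> :: "'n::finite triple \<Rightarrow> real ^ 'n"
    and x :: "'n triple"
  assumes "CARD('n) \<ge> 2"
    and "admissible_choice \<tau>"
  shows "optimal_solution x (outer_napoleon \<tau> (outer_napoleon \<tau> x)) \<and>
         (\<not> collinear_triple x \<longrightarrow> (\<exists>!y. optimal_solution x y))"
proof (cases "trivial_triple x")
  case True
  then obtain u where x: "x = (u, u, u)"
    by (cases x) auto
  \<comment> \<open>A trivial triple is equilateral, at distance 0 from itself; being collinear, it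
    makes the uniqueness claim vacuous.\<close>
  have "optimal_solution x x"
    by (auto simp: optimal_solution_def is_arg_min_linorder x)
  then show ?thesis
    using double_outer_napoleon_trivial[of \<tau> u] by (simp add: x del: napoleon.simps)
next
  case False
  obtain x1 x2 x3 where x: "x = (x1, x2, x3)"
    by (cases x)
  obtain n t \<alpha> \<beta> \<gamma> where fr: "orthonormal_pair n t"
    and rot: "\<And>z. rotation_mat \<tau> x *v z = bivector n t z"
    and x2: "x2 - x1 = \<alpha> *\<^sub>R n" and x3: "x3 - x1 = \<beta> *\<^sub>R n + \<gamma> *\<^sub>R t"
    and or: "\<alpha> * \<gamma> \<ge> 0" "\<not> collinear_triple x \<Longrightarrow> \<alpha> * \<gamma> > 0"
    using rotation_frame[OF assms(2) False[unfolded x]] unfolding x by metis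
  define m where "m = (1/3) *\<^sub>R (x1 + x2 + x3)"
  define a where "a = (1/3) *\<^sub>R (2 *\<^sub>R x1 - x2 - x3)"
  define b where "b = (1 / sqrt 3) *\<^sub>R (x2 - x3)"
  \<comment> \<open>Frame coordinates of \<open>a\<close> and \<open>b\<close>, read off from the
    edges \<open>x2 - x1\<close> and \<open>x3 - x1\<close>.\<close>
  define a1 a2 where "a1 = - (\<alpha> + \<beta>) / 3" and "a2 = - \<gamma> / 3"
  define b1 b2 where "b1 = (\<alpha> - \<beta>) / sqrt 3" and "b2 = - \<gamma> / sqrt 3"
  have xf: "x = fourier_triple m a b"
    unfolding x m_def a_def b_def by (rule triple_eq_fourier)
  have ab: "a = (- 1/3) *\<^sub>R ((x2 - x1) + (x3 - x1))" "b = (1 / sqrt 3) *\<^sub>R ((x2 - x1) - (x3 - x1))"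
    by (simp_all add: a_def b_def vec_eq_iff field_simps)
  have a: "a = a1 *\<^sub>R n + a2 *\<^sub>R t" and b: "b = b1 *\<^sub>R n + b2 *\<^sub>R t"
    unfolding ab x2 x3 by (simp_all add: a1_def a2_def b1_def b2_def vec_eq_iff field_simps)
  \<comment> \<open>The factor is the reciprocal of \<open>3 * sqrt 3 / 2\<close> from
    \<open>bivector_fourier\<close>.\<close>
  have area: "a1 * b2 - a2 * b1 = 2 * (\<alpha> * \<gamma>) / (3 * sqrt 3)"
    by (simp add: a1_def a2_def b1_def b2_def field_simps)
  then have area0: "a1 * b2 - a2 * b1 \<ge> 0"
    using or(1) by simp
  have ne: "a \<noteq> 0 \<or> b \<noteq> 0"
    using False by (auto simp: xf fourier_triple_def)
  define e f where "e = ((a1 + b2) / 2) *\<^sub>R n + ((a2 - b1) / 2) *\<^sub>R t"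
    and "f = (- ((a2 - b1) / 2)) *\<^sub>R n + ((a1 + b2) / 2) *\<^sub>R t"
  define y where "y = fourier_triple m e f"
  have N: "outer_napoleon \<tau> (outer_napoleon \<tau> x) = y"
    unfolding y_def e_def f_def xf
    by (rule double_outer_napoleon_fourier[OF assms(2) fr rot[unfolded xf] a b area0 ne])
  have "e \<bullet> e = f \<bullet> f" "e \<bullet> f = 0"
    using orthonormal_pairD[OF fr] by (simp_all add: e_def f_def inner_simps field_simps)
  then have eq_y: "equilateral y"
    by (simp add: y_def equilateral_fourier)
  \<comment> \<open>One gap serves both claims: dropping the last two terms gives optimality, and
    with \<open>\<kappa> > 0\<close> their vanishing gives uniqueness.\<close>
  have gap: "\<exists>\<kappa>\<ge>0. (a1 * b2 - a2 * b1 > 0 \<longrightarrow> \<kappa> > 0) \<and>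
      sq_distance x (fourier_triple m' p q) \<ge> sq_distance x y + 3 * (norm (m - m'))\<^sup>2
        + 3/2 * (\<kappa> * ((norm (e - p))\<^sup>2 + (norm (f - q))\<^sup>2))"
    if "equilateral (fourier_triple m' p q)" for m' p q
  proof -
    have pq: "p \<bullet> p = q \<bullet> q" "p \<bullet> q = 0"
      using that by (simp_all add: equilateral_fourier)
    obtain \<kappa> where "\<kappa> \<ge> 0" "a1 * b2 - a2 * b1 > 0 \<Longrightarrow> \<kappa> > 0"
      "(norm (a - p))\<^sup>2 + (norm (b - q))\<^sup>2 \<ge> (norm (a - e))\<^sup>2 + (norm (b - f))\<^sup>2
        + \<kappa> * ((norm (e - p))\<^sup>2 + (norm (f - q))\<^sup>2)"
      using conformal_approximation[OF fr pq area0 ne[unfolded a b]]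
      unfolding a b e_def f_def by metis
    then show ?thesis
      unfolding xf y_def sq_distance_fourier by (intro exI[of _ \<kappa>]) (auto simp: algebra_simps)
  qed
  have min: "sq_distance x y \<le> sq_distance x w" if w: "equilateral w" for w
  proof -
    obtain m' p q where wf: "w = fourier_triple m' p q"
      using triple_eq_fourier by (metis prod_cases3)
    obtain \<kappa> where "\<kappa> \<ge> 0" "sq_distance x w \<ge> sq_distance x y + 3 * (norm (m - m'))\<^sup>2
        + 3/2 * (\<kappa> * ((norm (e - p))\<^sup>2 + (norm (f - q))\<^sup>2))"
      using gap w unfolding wf by blast
    moreover from this(1) have "\<kappa> * ((norm (e - p))\<^sup>2 + (norm (f - q))\<^sup>2) \<ge> 0"
      by simp
    ultimately show ?thesis
      using zero_le_power2[of "norm (m - m')"] by linarith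
  qed
  have opt: "optimal_solution x y"
    using eq_y min by (simp add: optimal_solution_def is_arg_min_linorder)
  have uniq: "w = y" if nc: "\<not> collinear_triple x" and w: "optimal_solution x w" for w
  proof -
    have pos: "a1 * b2 - a2 * b1 > 0"
      using or(2)[OF nc] by (simp add: area)
    have w': "equilateral w" "sq_distance x w \<le> sq_distance x y"
      using w eq_y unfolding optimal_solution_def is_arg_min_linorder by blast+
    obtain m' p q where wf: "w = fourier_triple m' p q"
      using triple_eq_fourier by (metis prod_cases3)
    obtain \<kappa> where "\<kappa> > 0" and \<kappa>: "sq_distance x w \<ge> sq_distance x y + 3 * (norm (m - m'))\<^sup>2
        + 3/2 * (\<kappa> * ((norm (e - p))\<^sup>2 + (norm (f - q))\<^sup>2))"
      using gap w' pos unfolding wf by blast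
    \<comment> \<open>A competitor as good as \<open>y\<close> leaves no gap, so both nonnegative
      terms vanish and \<open>m' = m\<close>, \<open>p = e\<close>, \<open>q = f\<close>.\<close>
    have "3 * (norm (m - m'))\<^sup>2 + 3/2 * (\<kappa> * ((norm (e - p))\<^sup>2 + (norm (f - q))\<^sup>2)) \<le> 0"
      using \<kappa> w'(2) by simp
    moreover have "\<kappa> * ((norm (e - p))\<^sup>2 + (norm (f - q))\<^sup>2) \<ge> 0"
      using \<open>\<kappa> > 0\<close> by simp
    ultimately have "(norm (m - m'))\<^sup>2 = 0" "\<kappa> * ((norm (e - p))\<^sup>2 + (norm (f - q))\<^sup>2) = 0"
      using zero_le_power2[of "norm (m - m')"] by linarith+
    then show ?thesis
      using \<open>\<kappa> > 0\<close> by (simp add: wf y_def sum_power2_eq_zero_iff)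
  qed
  show ?thesis
    unfolding N using opt uniq by blast
qed

end
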